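(* Let $G=(V,E)$ be a locally finite, connected weighted graph with uniformly positive measure and symmetric, uniformly bounded weights (precise conditions in the context). Let $W^{1,2}(V)$ be the space of all functions $u:V\to\mathbb R$ with $\|u\|_{W^{1,2}(V)}^2=\int_V(|\nabla u|^2+u^2)d\mu<+\infty$. Then $W^{1,2}(V)$ is the completion of $C_c(V)$ under the norm $\|\cdot\|_{W^{1,2}(V)}$.
   Context: $G=(V,E)$ is a graph with vertex set $V$ and edge set $E$; $y\sim x$ means $xy\in E$. It is assumed that: each vertex has finitely many neighbours (locally finite); any two vertices can be joined by finitely many edges (connected); there is a measure $\mu:V\to(0,\infty)$ and a constant $\mu_{\min}>0$ with $\mu(x)\ge\mu_{\min}$ for all $x\in V$; each edge $xy$ has a positive weight $\omega_{xy}=\omega_{yx}$, and there is a constant $C$ with $\sum_{y\sim x}\omega_{xy}<C$ for all $x\in V$. For $u:V\to\mathbb R$: $|\nabla u|^2(x)=\frac1{2\mu(x)}\sum_{y\sim x}\omega_{xy}(u(y)-u(x))^2$ and $\int_V u\,d\mu=\sum_{x\in V}\mu(x)u(x)$. $C_c(V)$ is the set of functions $V\to\mathbb R$ with finite support. *)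

theory Defs
  imports "HOL-Analysis.Analysis" "HOL-Library.Function_Algebras"
begin

instantiation "fun" :: (type, real_vector) real_vector
begin

definition scaleR_fun :: "real \<Rightarrow> ('a \<Rightarrow> 'b) \<Rightarrow> 'a \<Rightarrow> 'b" where
  "scaleR_fun c f = (\<lambda>x. c *\<^sub>R f x)"

instance
  by standard (simp_all add: scaleR_fun_def fun_eq_iff algebra_simps)

end

lemma scaleR_fun_apply [simp]: "(c *\<^sub>R f) x = c *\<^sub>R f x"
  by (simp add: scaleR_fun_def)


section \<open>Completions of normed spaces\<close>

definition normed_subspace :: "'f::real_vector set \<Rightarrow> ('f \<Rightarrow> real) \<Rightarrow> bool" where
  "normed_subspace S N \<longleftrightarrow> subspace S
     \<and> (\<forall>u\<in>S. 0 \<le> N u)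
     \<and> (\<forall>u\<in>S. N u = 0 \<longleftrightarrow> u = 0)
     \<and> (\<forall>c. \<forall>u\<in>S. N (c *\<^sub>R u) = \<bar>c\<bar> * N u)
     \<and> (\<forall>u\<in>S. \<forall>v\<in>S. N (u + v) \<le> N u + N v)"

text \<open>
  \<open>W\<close> is the completion of \<open>S\<close> under the norm \<open>N\<close>, the embedding being the inclusion:
  \<open>W\<close> is a Banach space and \<open>S\<close> is a dense linear subspace carrying the restricted norm.
  The operations of \<open>Metric_space\<close> have their intended meaning because \<open>normed_subspace W N\<close>
  makes \<open>N (u - v)\<close> a metric on \<open>W\<close>.
\<close>

definition is_completion :: "('f::real_vector \<Rightarrow> real) \<Rightarrow> 'f set \<Rightarrow> 'f set \<Rightarrow> bool" where
  "is_completion N S W \<longleftrightarrow>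
     normed_subspace W N
     \<and> Metric_space.mcomplete W (\<lambda>u v. N (u - v))
     \<and> subspace S \<and> S \<subseteq> W
     \<and> Metric_space.mtopology W (\<lambda>u v. N (u - v)) closure_of S = W"


section \<open>Weighted graphs\<close>

text \<open>
  The vertex set is the type \<open>'v\<close>; an edge \<open>xy\<close> is the set \<open>{x, y}\<close>. Loops are not
  excluded. The weight \<open>\<omega> x y\<close> is only meaningful when \<open>{x, y} \<in> E\<close>.
\<close>

definition neighbours :: "'v set set \<Rightarrow> 'v \<Rightarrow> 'v set" where
  "neighbours E x = {y. {x, y} \<in> E}"

locale weighted_graph =
  fixes E :: "'v set set" and \<mu> :: "'v \<Rightarrow> real" and \<omega> :: "'v \<Rightarrow> 'v \<Rightarrow> real"
  assumes edges: "e \<in> E \<Longrightarrow> \<exists>x y. e = {x, y}"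
    and locally_finite: "finite (neighbours E x)"
    and connected: "(x, y) \<in> {(a, b). b \<in> neighbours E a}\<^sup>*"
    and measure_pos: "0 < \<mu> x"
    and measure_bounded_below: "\<exists>\<mu>\<^sub>m\<^sub>i\<^sub>n > 0. \<forall>x. \<mu>\<^sub>m\<^sub>i\<^sub>n \<le> \<mu> x"
    and weight_pos: "{x, y} \<in> E \<Longrightarrow> 0 < \<omega> x y"
    and weight_sym: "{x, y} \<in> E \<Longrightarrow> \<omega> x y = \<omega> y x"
    and weight_bounded: "\<exists>C. \<forall>x. (\<Sum>y\<in>neighbours E x. \<omega> x y) < C"


section \<open>The Sobolev space\<close>

definition grad_sq ::
  "'v set set \<Rightarrow> ('v \<Rightarrow> real) \<Rightarrow> ('v \<Rightarrow> 'v \<Rightarrow> real) \<Rightarrow> ('v \<Rightarrow> real) \<Rightarrow> 'v \<Rightarrow> real" where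
  "grad_sq E \<mu> \<omega> u x = 1 / (2 * \<mu> x) * (\<Sum>y\<in>neighbours E x. \<omega> x y * (u y - u x)\<^sup>2)"

text \<open>
  Since \<open>infsum\<close> is 0 on families that are not summable, finiteness of an integral is a
  separate predicate; for a nonnegative integrand it says that the integral is \<open>< \<infinity>\<close>.
\<close>

definition graph_integrable :: "('v \<Rightarrow> real) \<Rightarrow> ('v \<Rightarrow> real) \<Rightarrow> bool" where
  "graph_integrable \<mu> u \<longleftrightarrow> (\<lambda>x. \<mu> x * u x) summable_on UNIV"

definition graph_integral :: "('v \<Rightarrow> real) \<Rightarrow> ('v \<Rightarrow> real) \<Rightarrow> real" where
  "graph_integral \<mu> u = (\<Sum>\<^sub>\<infinity>x. \<mu> x * u x)"

definition W12 ::
  "'v set set \<Rightarrow> ('v \<Rightarrow> real) \<Rightarrow> ('v \<Rightarrow> 'v \<Rightarrow> real) \<Rightarrow> ('v \<Rightarrow> real) set" where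
  "W12 E \<mu> \<omega> = {u. graph_integrable \<mu> (\<lambda>x. grad_sq E \<mu> \<omega> u x + (u x)\<^sup>2)}"

definition W12_norm ::
  "'v set set \<Rightarrow> ('v \<Rightarrow> real) \<Rightarrow> ('v \<Rightarrow> 'v \<Rightarrow> real) \<Rightarrow> ('v \<Rightarrow> real) \<Rightarrow> real" where
  "W12_norm E \<mu> \<omega> u = sqrt (graph_integral \<mu> (\<lambda>x. grad_sq E \<mu> \<omega> u x + (u x)\<^sup>2))"

definition finitely_supported :: "('v \<Rightarrow> real) set" where
  "finitely_supported = {u. finite {x. u x \<noteq> 0}}"

end

theory Submission
  imports Defs
begin

text \<open>
  The \<open>W\<^sup>1\<^sup>,\<^sup>2\<close> norm is the supremum, over finite vertex sets \<open>F\<close>, of the seminorms that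
  integrate over \<open>F\<close> only. Each of these is continuous under pointwise convergence, which
  yields the norm axioms and, because the norm controls point values, completeness. For
  density, symmetry and boundedness of the weights bound the gradient term by a multiple of
  \<open>\<integral> u\<^sup>2 d\<mu>\<close>, so that truncating a function to a large finite set changes it little in norm.
\<close>

context weighted_graph
begin

section \<open>Seminorms at a single vertex and over finite vertex sets\<close>

definition local_norm :: "('v \<Rightarrow> real) \<Rightarrow> 'v \<Rightarrow> real" where
  "local_norm u x = sqrt (\<mu> x * (grad_sq E \<mu> \<omega> u x + (u x)\<^sup>2))"

text \<open>Building this with \<open>L2_set\<close>, rather than as the root of a sum of densities,
  lets Minkowski's inequality carry the triangle inequality from single vertices to
  \<open>F\<close>.\<close>

definition norm_on :: "'v set \<Rightarrow> ('v \<Rightarrow> real) \<Rightarrow> real" where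
  "norm_on F u = L2_set (local_norm u) F"

lemma weight_nonneg: "y \<in> neighbours E x \<Longrightarrow> 0 \<le> \<omega> x y"
  using weight_pos by (force simp: neighbours_def intro: less_imp_le)

lemma neighbours_sym: "y \<in> neighbours E x \<longleftrightarrow> x \<in> neighbours E y"
  by (simp add: neighbours_def insert_commute)

lemma density_eq:
  "\<mu> x * (grad_sq E \<mu> \<omega> u x + (u x)\<^sup>2)
     = (\<Sum>y\<in>neighbours E x. \<omega> x y * (u y - u x)\<^sup>2) / 2 + \<mu> x * (u x)\<^sup>2"
  using measure_pos[of x] by (simp add: grad_sq_def field_simps)

lemma density_nonneg: "0 \<le> \<mu> x * (grad_sq E \<mu> \<omega> u x + (u x)\<^sup>2)"
  unfolding density_eq using measure_pos[of x] weight_nonneg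
  by (intro add_nonneg_nonneg divide_nonneg_nonneg sum_nonneg mult_nonneg_nonneg) auto

lemma local_norm_nonneg: "0 \<le> local_norm u x"
  by (simp add: local_norm_def density_nonneg)

lemma local_norm_sq: "(local_norm u x)\<^sup>2 = \<mu> x * (grad_sq E \<mu> \<omega> u x + (u x)\<^sup>2)"
  by (simp add: local_norm_def density_nonneg)

text \<open>Exhibits \<open>local_norm u x\<close> as the Euclidean length of a vector depending
  linearly on \<open>u\<close>: the weighted differences along the edges at \<open>x\<close>,
  together with the weighted value at \<open>x\<close>.\<close>

lemma local_norm_eq_L2:
  "local_norm u x = sqrt ((L2_set (\<lambda>y. sqrt (\<omega> x y / 2) * (u y - u x)) (neighbours E x))\<^sup>2
     + (sqrt (\<mu> x) * u x)\<^sup>2)"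
  using measure_pos[of x] weight_nonneg[of _ x]
  by (simp add: local_norm_def density_eq L2_set_def power_mult_distrib sum_nonneg
      sum_divide_distrib)

lemma local_norm_triangle: "local_norm (u + v) x \<le> local_norm u x + local_norm v x"
proof -
  let ?D = "\<lambda>w y. sqrt (\<omega> x y / 2) * (w y - w x)"
  let ?L = "\<lambda>w. L2_set (?D w) (neighbours E x)"
  have "?D (u + v) = (\<lambda>y. ?D u y + ?D v y)"
    by (auto simp: fun_eq_iff algebra_simps)
  then have "?L (u + v) \<le> ?L u + ?L v"
    by (simp only: L2_set_triangle_ineq)
  \<comment> \<open>Minkowski over the neighbours has bounded the gradient component. The planar
    inequality below then combines the gradient and value components.\<close>
  then have "local_norm (u + v) x
      \<le> sqrt ((?L u + ?L v)\<^sup>2 + (sqrt (\<mu> x) * u x + sqrt (\<mu> x) * v x)\<^sup>2)"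
    unfolding local_norm_eq_L2 plus_fun_apply distrib_left[of "sqrt (\<mu> x)"]
    by (intro real_sqrt_le_mono add_right_mono power_mono L2_set_nonneg)
  also have "\<dots> \<le> local_norm u x + local_norm v x"
    unfolding local_norm_eq_L2 by (rule real_sqrt_sum_squares_triangle_ineq)
  finally show ?thesis .
qed

lemma density_scaleR:
  "\<mu> x * (grad_sq E \<mu> \<omega> (c *\<^sub>R u) x + ((c *\<^sub>R u) x)\<^sup>2)
     = c\<^sup>2 * (\<mu> x * (grad_sq E \<mu> \<omega> u x + (u x)\<^sup>2))"
proof -
  have "(\<Sum>y\<in>neighbours E x. \<omega> x y * (c * u y - c * u x)\<^sup>2)
      = c\<^sup>2 * (\<Sum>y\<in>neighbours E x. \<omega> x y * (u y - u x)\<^sup>2)"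
    unfolding sum_distrib_left
    by (intro sum.cong refl) (simp add: power2_eq_square algebra_simps)
  then show ?thesis
    unfolding density_eq
    by (simp add: power_mult_distrib distrib_left)
qed

lemma local_norm_scaleR: "local_norm (c *\<^sub>R u) x = \<bar>c\<bar> * local_norm u x"
  unfolding local_norm_def density_scaleR by (simp only: real_sqrt_mult real_sqrt_abs)

text \<open>Only the values of \<open>u\<close> at \<open>x\<close> and its finitely many neighbours
  enter, and they enter continuously, so pointwise convergence suffices.\<close>

lemma tendsto_local_norm:
  assumes "\<And>x. (\<lambda>n. f n x) \<longlonglongrightarrow> u x"
  shows "(\<lambda>n. local_norm (f n) x) \<longlonglongrightarrow> local_norm u x"
  unfolding local_norm_def density_eq by (auto intro!: tendsto_intros assms)

lemma norm_on_sq: "(norm_on F u)\<^sup>2 = (\<Sum>x\<in>F. \<mu> x * (grad_sq E \<mu> \<omega> u x + (u x)\<^sup>2))"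
  by (simp add: norm_on_def L2_set_def sum_nonneg density_nonneg local_norm_sq)

lemma norm_on_nonneg: "0 \<le> norm_on F u"
  by (simp add: norm_on_def)

lemma norm_on_triangle: "norm_on F (u + v) \<le> norm_on F u + norm_on F v"
proof -
  have "norm_on F (u + v) \<le> L2_set (\<lambda>x. local_norm u x + local_norm v x) F"
    unfolding norm_on_def
    by (intro L2_set_mono local_norm_triangle local_norm_nonneg)
  also have "\<dots> \<le> norm_on F u + norm_on F v"
    unfolding norm_on_def by (rule L2_set_triangle_ineq)
  finally show ?thesis .
qed

lemma norm_on_scaleR: "norm_on F (c *\<^sub>R u) = \<bar>c\<bar> * norm_on F u"
  by (simp add: norm_on_def L2_set_right_distrib local_norm_scaleR[abs_def])

lemma tendsto_norm_on:
  assumes "\<And>x. (\<lambda>n. f n x) \<longlonglongrightarrow> u x"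
  shows "(\<lambda>n. norm_on F (f n)) \<longlonglongrightarrow> norm_on F u"
  unfolding norm_on_def L2_set_def by (intro tendsto_intros tendsto_local_norm) (rule assms)

section \<open>The W12 norm as a supremum over finite sets, and the norm axioms\<close>

lemma W12_norm_nonneg: "0 \<le> W12_norm E \<mu> \<omega> u"
  by (simp add: W12_norm_def graph_integral_def infsum_nonneg density_nonneg)

lemma norm_on_le_W12_norm:
  assumes "u \<in> W12 E \<mu> \<omega>" "finite F"
  shows "norm_on F u \<le> W12_norm E \<mu> \<omega> u"
proof -
  have "(norm_on F u)\<^sup>2 \<le> graph_integral \<mu> (\<lambda>x. grad_sq E \<mu> \<omega> u x + (u x)\<^sup>2)"
    unfolding norm_on_sq graph_integral_def using assms
    by (intro finite_sum_le_infsum density_nonneg) (auto simp: W12_def graph_integrable_def)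
  then show ?thesis
    unfolding W12_norm_def by (rule real_le_rsqrt)
qed

text \<open>A sum of nonnegative terms with bounded finite partial sums converges, and its value
  obeys the same bound. This is how membership in W12 and norm estimates are obtained together for
  sums, limits and truncation errors.\<close>

lemma W12_bounded:
  assumes bound: "\<And>F. finite F \<Longrightarrow> norm_on F u \<le> B"
  shows "u \<in> W12 E \<mu> \<omega>" "W12_norm E \<mu> \<omega> u \<le> B"
proof -
  have B: "(\<Sum>x\<in>F. \<mu> x * (grad_sq E \<mu> \<omega> u x + (u x)\<^sup>2)) \<le> B\<^sup>2" if "finite F" for F
    using power_mono[OF bound[OF that] norm_on_nonneg, of 2] by (simp add: norm_on_sq)
  have "0 \<le> B"
    using bound[of "{}"] by (simp add: norm_on_def)
  have summable: "(\<lambda>x. \<mu> x * (grad_sq E \<mu> \<omega> u x + (u x)\<^sup>2)) summable_on UNIV"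
    using B by (intro nonneg_bdd_above_summable_on density_nonneg bdd_aboveI2) auto
  then show "u \<in> W12 E \<mu> \<omega>"
    by (simp add: W12_def graph_integrable_def)
  have "graph_integral \<mu> (\<lambda>x. grad_sq E \<mu> \<omega> u x + (u x)\<^sup>2) \<le> B\<^sup>2"
    unfolding graph_integral_def by (rule infsum_le_finite_sums[OF summable B])
  then show "W12_norm E \<mu> \<omega> u \<le> B"
    unfolding W12_norm_def using \<open>0 \<le> B\<close> by (rule real_le_lsqrt[rotated])
qed

text \<open>Take the one-point set \<open>{x}\<close> and drop the gradient term. As
  \<open>\<mu> x\<close> is positive, point evaluation is continuous in the norm; this gives
  definiteness and pointwise limits of Cauchy sequences.\<close>

lemma abs_le_W12_norm:
  assumes "u \<in> W12 E \<mu> \<omega>"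
  shows "sqrt (\<mu> x) * \<bar>u x\<bar> \<le> W12_norm E \<mu> \<omega> u"
proof -
  have "sqrt (\<mu> x) * \<bar>u x\<bar> = sqrt ((sqrt (\<mu> x) * u x)\<^sup>2)"
    using measure_pos[of x] by (simp add: abs_mult)
  also have "\<dots> \<le> local_norm u x"
    unfolding local_norm_eq_L2 by (rule real_sqrt_le_mono) simp
  also have "\<dots> = norm_on {x} u"
    by (simp add: norm_on_def local_norm_nonneg)
  also have "\<dots> \<le> W12_norm E \<mu> \<omega> u"
    using assms by (intro norm_on_le_W12_norm) auto
  finally show ?thesis .
qed

lemma W12_add:
  assumes "u \<in> W12 E \<mu> \<omega>" "v \<in> W12 E \<mu> \<omega>"
  shows "u + v \<in> W12 E \<mu> \<omega>"
    and "W12_norm E \<mu> \<omega> (u + v) \<le> W12_norm E \<mu> \<omega> u + W12_norm E \<mu> \<omega> v"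
proof -
  have "norm_on F (u + v) \<le> W12_norm E \<mu> \<omega> u + W12_norm E \<mu> \<omega> v" if "finite F" for F
    using norm_on_triangle[of F u v] norm_on_le_W12_norm[OF assms(1) that]
      norm_on_le_W12_norm[OF assms(2) that] by linarith
  from W12_bounded[OF this] show "u + v \<in> W12 E \<mu> \<omega>"
    and "W12_norm E \<mu> \<omega> (u + v) \<le> W12_norm E \<mu> \<omega> u + W12_norm E \<mu> \<omega> v"
    by auto
qed

lemma W12_scaleR: "u \<in> W12 E \<mu> \<omega> \<Longrightarrow> c *\<^sub>R u \<in> W12 E \<mu> \<omega>"
  unfolding W12_def graph_integrable_def mem_Collect_eq density_scaleR
  by (rule summable_on_cmult_right)

lemma W12_norm_scaleR: "W12_norm E \<mu> \<omega> (c *\<^sub>R u) = \<bar>c\<bar> * W12_norm E \<mu> \<omega> u"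
  unfolding W12_norm_def graph_integral_def density_scaleR
  by (simp only: infsum_cmult_right' real_sqrt_mult real_sqrt_abs)

lemma normed_subspace_W12: "normed_subspace (W12 E \<mu> \<omega>) (W12_norm E \<mu> \<omega>)"
proof -
  have zero: "W12_norm E \<mu> \<omega> 0 = 0"
    using W12_norm_scaleR[of 0 0] by simp
  have "0 \<in> W12 E \<mu> \<omega>"
    by (rule W12_bounded(1)[of _ 0]) (use norm_on_scaleR[of _ 0 0] in simp)
  moreover have "u = 0" if "u \<in> W12 E \<mu> \<omega>" "W12_norm E \<mu> \<omega> u = 0" for u
  proof
    fix x
    show "u x = 0 x"
      using abs_le_W12_norm[OF that(1), of x] that(2) measure_pos[of x]
      by (simp add: mult_le_0_iff)
  qed
  ultimately show ?thesis
    unfolding normed_subspace_def subspace_def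
    by (auto intro: W12_add W12_scaleR W12_norm_scaleR W12_norm_nonneg simp: zero)
qed

section \<open>The induced metric and its completeness\<close>

lemma W12_diff: "u \<in> W12 E \<mu> \<omega> \<Longrightarrow> v \<in> W12 E \<mu> \<omega> \<Longrightarrow> u - v \<in> W12 E \<mu> \<omega>"
  using normed_subspace_W12 by (auto simp: normed_subspace_def intro: subspace_diff)

lemma W12_norm_minus_commute: "W12_norm E \<mu> \<omega> (u - v) = W12_norm E \<mu> \<omega> (v - u)"
  using W12_norm_scaleR[of "-1" "u - v"] by simp

lemma Metric_space_W12: "Metric_space (W12 E \<mu> \<omega>) (\<lambda>u v. W12_norm E \<mu> \<omega> (u - v))"
proof
  fix u v w :: "'v \<Rightarrow> real"
  assume "u \<in> W12 E \<mu> \<omega>" "v \<in> W12 E \<mu> \<omega>"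
  then have uv: "u - v \<in> W12 E \<mu> \<omega>"
    by (rule W12_diff)
  show "W12_norm E \<mu> \<omega> (u - v) = 0 \<longleftrightarrow> u = v"
    using normed_subspace_W12 uv by (simp add: normed_subspace_def)
  assume "w \<in> W12 E \<mu> \<omega>"
  then have "v - w \<in> W12 E \<mu> \<omega>"
    using \<open>v \<in> W12 E \<mu> \<omega>\<close> by (intro W12_diff)
  from W12_add(2)[OF uv this]
  show "W12_norm E \<mu> \<omega> (u - w) \<le> W12_norm E \<mu> \<omega> (u - v) + W12_norm E \<mu> \<omega> (v - w)"
    by simp
qed (auto intro: W12_norm_nonneg W12_norm_minus_commute)

lemma mcomplete_W12:
  "Metric_space.mcomplete (W12 E \<mu> \<omega>) (\<lambda>u v. W12_norm E \<mu> \<omega> (u - v))"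
proof -
  interpret W: Metric_space "W12 E \<mu> \<omega>" "\<lambda>u v. W12_norm E \<mu> \<omega> (u - v)"
    by (rule Metric_space_W12)
  show ?thesis
    unfolding W.mcomplete_def
  proof (intro allI impI)
    fix f assume "W.MCauchy f"
    then have f: "f n \<in> W12 E \<mu> \<omega>" for n
      by (auto simp: W.MCauchy_def)
    have Cauchy_f: "\<exists>M. \<forall>m\<ge>M. \<forall>n\<ge>M. W12_norm E \<mu> \<omega> (f m - f n) < \<epsilon>" if "\<epsilon> > 0" for \<epsilon>
      using \<open>W.MCauchy f\<close> that by (simp add: W.MCauchy_def)
    have "Cauchy (\<lambda>n. f n x)" for x
    proof (rule metric_CauchyI)
      fix e :: real assume "e > 0"
      \<comment> \<open>This tolerance cancels the factor \<open>sqrt (\<mu> x)\<close> in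
        \<open>abs_le_W12_norm\<close>. It may depend on \<open>x\<close>, since only pointwise
        convergence is sought.\<close>
      then have "sqrt (\<mu> x) * e > 0"
        using measure_pos by simp
      then obtain M where M: "\<And>m n. m \<ge> M \<Longrightarrow> n \<ge> M \<Longrightarrow>
          W12_norm E \<mu> \<omega> (f m - f n) < sqrt (\<mu> x) * e"
        using Cauchy_f by meson
      have "dist (f m x) (f n x) < e" if "m \<ge> M" "n \<ge> M" for m n
        using order_le_less_trans[OF abs_le_W12_norm[OF W12_diff[OF f f], of x] M[OF that]]
          measure_pos[of x] by (simp add: dist_real_def)
      then show "\<exists>M. \<forall>m\<ge>M. \<forall>n\<ge>M. dist (f m x) (f n x) < e"
        by blast
    qed
    then have "\<forall>x. \<exists>l. (\<lambda>n. f n x) \<longlonglongrightarrow> l"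
      by (simp add: Cauchy_convergent_iff convergent_def)
    then obtain u where u: "\<And>x. (\<lambda>n. f n x) \<longlonglongrightarrow> u x"
      by metis
    \<comment> \<open>Membership of \<open>f n - u\<close> is part of the claim because
      \<open>u\<close> is not yet known to lie in W12.\<close>
    have close: "\<exists>M. \<forall>n\<ge>M. f n - u \<in> W12 E \<mu> \<omega> \<and> W12_norm E \<mu> \<omega> (f n - u) \<le> \<epsilon>"
      if "\<epsilon> > 0" for \<epsilon>
    proof -
      obtain M where M: "\<And>m n. m \<ge> M \<Longrightarrow> n \<ge> M \<Longrightarrow> W12_norm E \<mu> \<omega> (f m - f n) < \<epsilon>"
        using Cauchy_f[OF \<open>\<epsilon> > 0\<close>] by meson
      \<comment> \<open>The limit in \<open>m\<close> is taken with \<open>n\<close> and the finite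
        set \<open>F\<close> fixed. Since \<open>M\<close> does not depend on \<open>F\<close>,
        \<open>W12_bounded\<close> then applies.\<close>
      have bound: "norm_on F (f n - u) \<le> \<epsilon>" if "n \<ge> M" "finite F" for n F
      proof (rule Lim_bounded)
        show "(\<lambda>m. norm_on F (f n - f m)) \<longlonglongrightarrow> norm_on F (f n - u)"
          by (rule tendsto_norm_on) (auto intro!: tendsto_intros u)
        show "\<forall>m\<ge>M. norm_on F (f n - f m) \<le> \<epsilon>"
          using norm_on_le_W12_norm[OF W12_diff[OF f f] \<open>finite F\<close>] M[OF \<open>n \<ge> M\<close>]
          by (meson less_imp_le order_trans)
      qed
      show ?thesis
        using W12_bounded[OF bound] by blast
    qed
    obtain M where "f M - u \<in> W12 E \<mu> \<omega>"
      using close[of 1] by auto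
    \<comment> \<open>Here \<open>u\<close> is recovered as \<open>f M - (f M - u)\<close>.\<close>
    from W12_diff[OF f[of M] this] have "u \<in> W12 E \<mu> \<omega>"
      by simp
    moreover have "\<exists>M. \<forall>n\<ge>M. f n \<in> W12 E \<mu> \<omega> \<and> W12_norm E \<mu> \<omega> (f n - u) < \<epsilon>"
      if "\<epsilon> > 0" for \<epsilon>
    proof -
      \<comment> \<open>Passing to the limit kept only a non-strict bound; halving restores the
        strict one.\<close>
      have "\<epsilon> / 2 > 0" using that by simp
      from close[OF this] obtain M where "\<forall>n\<ge>M. W12_norm E \<mu> \<omega> (f n - u) \<le> \<epsilon> / 2"
        by blast
      then show ?thesis
        using f that by (intro exI[of _ M]) force
    qed
    ultimately show "\<exists>u. limitin W.mtopology f u sequentially"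
      unfolding W.limitin_metric eventually_sequentially by blast
  qed
qed

section \<open>Control of the gradient by the L2 norm, and density of finitely supported
  functions\<close>

text \<open>Splitting each squared difference leaves two sums of weighted squares. Each is at most
  \<open>C / m * B\<close>: the one with \<open>v x\<close> directly by the weight bound, the one
  with \<open>v y\<close> after exchanging the summations and using symmetry of the weights. The
  constant depends on neither \<open>v\<close> nor \<open>F\<close>, and bounding finite sums by
  \<open>B\<close> avoids infinite sums here.\<close>

lemma norm_on_sq_le_L2:
  obtains K where "K > 0" and
    "\<And>v B F. (\<And>G. finite G \<Longrightarrow> (\<Sum>x\<in>G. \<mu> x * (v x)\<^sup>2) \<le> B) \<Longrightarrow> finite F \<Longrightarrow>
       (norm_on F v)\<^sup>2 \<le> K * B"
proof -
  obtain m where m: "m > 0" "\<And>x. m \<le> \<mu> x"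
    using measure_bounded_below by blast
  obtain C where C: "\<And>x. (\<Sum>y\<in>neighbours E x. \<omega> x y) < C"
    using weight_bounded by blast
  have "C > 0"
    \<comment> \<open>Any vertex serves: a sum of nonnegative weights lies strictly below
      \<open>C\<close>.\<close>
    using C[of undefined] weight_nonneg by (meson order_le_less_trans sum_nonneg)
  have main: "(norm_on F v)\<^sup>2 \<le> (2 * C / m + 1) * B"
    if bound: "\<And>G. finite G \<Longrightarrow> (\<Sum>x\<in>G. \<mu> x * (v x)\<^sup>2) \<le> B" and "finite F" for v B F
  proof -
    define G where "G = (\<Union>x\<in>F. neighbours E x)"
    have "finite G"
      using \<open>finite F\<close> locally_finite by (auto simp: G_def)
    \<comment> \<open>The lower bound \<open>m\<close> on the measure turns an unweighted sum of
      squares into a \<open>\<mu>\<close>-weighted one.\<close>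
    have C_bound: "(\<Sum>x\<in>H. C * (v x)\<^sup>2) \<le> C / m * B" if "finite H" for H
    proof -
      have "(\<Sum>x\<in>H. C * (v x)\<^sup>2) \<le> (\<Sum>x\<in>H. C / m * (\<mu> x * (v x)\<^sup>2))"
      proof (rule sum_mono)
        fix x
        have "C / m * (m * (v x)\<^sup>2) \<le> C / m * (\<mu> x * (v x)\<^sup>2)"
          using m \<open>C > 0\<close> by (intro mult_left_mono mult_right_mono) auto
        then show "C * (v x)\<^sup>2 \<le> C / m * (\<mu> x * (v x)\<^sup>2)"
          using m by simp
      qed
      also have "\<dots> \<le> C / m * B"
        unfolding sum_distrib_left[symmetric] using m \<open>C > 0\<close> bound[OF that]
        by (intro mult_left_mono) auto
      finally show ?thesis .
    qed
    have "(\<Sum>x\<in>F. \<Sum>y\<in>neighbours E x. \<omega> x y * (v x)\<^sup>2) \<le> (\<Sum>x\<in>F. C * (v x)\<^sup>2)"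
      unfolding sum_distrib_right[symmetric]
      using C by (intro sum_mono mult_right_mono) (auto intro: less_imp_le)
    then have own: "(\<Sum>x\<in>F. \<Sum>y\<in>neighbours E x. \<omega> x y * (v x)\<^sup>2) \<le> C / m * B"
      using C_bound[OF \<open>finite F\<close>] by linarith
    \<comment> \<open>The neighbours of \<open>F\<close> may lie outside \<open>F\<close>;
      restricting \<open>y\<close> to the finite set \<open>G\<close> containing them all makes both
      index sets fixed, so the sums can be exchanged.\<close>
    have "(\<Sum>x\<in>F. \<Sum>y\<in>neighbours E x. \<omega> x y * (v y)\<^sup>2)
        = (\<Sum>x\<in>F. \<Sum>y | y \<in> G \<and> y \<in> neighbours E x. \<omega> x y * (v y)\<^sup>2)"
      by (intro sum.cong refl) (auto simp: G_def)
    also have "\<dots> = (\<Sum>y\<in>G. \<Sum>x | x \<in> F \<and> y \<in> neighbours E x. \<omega> x y * (v y)\<^sup>2)"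
      using \<open>finite F\<close> \<open>finite G\<close> by (rule sum.swap_restrict)
    also have "\<dots> \<le> (\<Sum>y\<in>G. \<Sum>x\<in>neighbours E y. \<omega> y x * (v y)\<^sup>2)"
    proof (rule sum_mono)
      fix y
      have "(\<Sum>x | x \<in> F \<and> y \<in> neighbours E x. \<omega> x y * (v y)\<^sup>2)
          = (\<Sum>x | x \<in> F \<and> y \<in> neighbours E x. \<omega> y x * (v y)\<^sup>2)"
        by (intro sum.cong refl) (auto simp: neighbours_def dest: weight_sym)
      \<comment> \<open>Enlarging the range to all neighbours of \<open>y\<close> adds only
        nonnegative terms and produces the full weight sum at \<open>y\<close>, which is below
        \<open>C\<close>.\<close>
      also have "\<dots> \<le> (\<Sum>x\<in>neighbours E y. \<omega> y x * (v y)\<^sup>2)"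
        using locally_finite weight_nonneg by (intro sum_mono2) (auto simp: neighbours_sym)
      finally show "(\<Sum>x | x \<in> F \<and> y \<in> neighbours E x. \<omega> x y * (v y)\<^sup>2)
          \<le> (\<Sum>x\<in>neighbours E y. \<omega> y x * (v y)\<^sup>2)" .
    qed
    also have "\<dots> \<le> (\<Sum>y\<in>G. C * (v y)\<^sup>2)"
      unfolding sum_distrib_right[symmetric]
      using C by (intro sum_mono mult_right_mono) (auto intro: less_imp_le)
    also have "\<dots> \<le> C / m * B"
      by (rule C_bound) fact
    finally have other: "(\<Sum>x\<in>F. \<Sum>y\<in>neighbours E x. \<omega> x y * (v y)\<^sup>2) \<le> C / m * B" .
    have "(\<Sum>y\<in>neighbours E x. \<omega> x y * (v y - v x)\<^sup>2) / 2
        \<le> (\<Sum>y\<in>neighbours E x. \<omega> x y * (v y)\<^sup>2) + (\<Sum>y\<in>neighbours E x. \<omega> x y * (v x)\<^sup>2)"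
      for x
      unfolding sum_divide_distrib sum.distrib[symmetric]
    proof (rule sum_mono)
      fix y assume "y \<in> neighbours E x"
      have "(v y - v x)\<^sup>2 / 2 \<le> (v y)\<^sup>2 + (v x)\<^sup>2"
        using zero_le_power2[of "v y + v x"] by (simp add: power2_sum power2_diff)
      then show "\<omega> x y * (v y - v x)\<^sup>2 / 2 \<le> \<omega> x y * (v y)\<^sup>2 + \<omega> x y * (v x)\<^sup>2"
        using mult_left_mono[OF _ weight_nonneg[OF \<open>y \<in> neighbours E x\<close>]]
        by (fastforce simp: distrib_left)
    qed
    then have "(norm_on F v)\<^sup>2 \<le> (\<Sum>x\<in>F. (\<Sum>y\<in>neighbours E x. \<omega> x y * (v y)\<^sup>2)
        + (\<Sum>y\<in>neighbours E x. \<omega> x y * (v x)\<^sup>2) + \<mu> x * (v x)\<^sup>2)"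
      unfolding norm_on_sq density_eq by (intro sum_mono add_right_mono)
    also have "\<dots> \<le> C / m * B + C / m * B + B"
      unfolding sum.distrib using own other bound[OF \<open>finite F\<close>] by (intro add_mono)
    finally show ?thesis
      by (simp add: algebra_simps)
  qed
  show thesis
    by (rule that[OF _ main]) (use m \<open>C > 0\<close> in \<open>auto simp: add_pos_pos\<close>)
qed

lemma finitely_supported_subset_W12: "finitely_supported \<subseteq> W12 E \<mu> \<omega>"
proof
  fix v :: "'v \<Rightarrow> real" assume "v \<in> finitely_supported"
  then have fin: "finite {x. v x \<noteq> 0}"
    by (simp add: finitely_supported_def)
  obtain K where K: "\<And>v B F. (\<And>G. finite G \<Longrightarrow> (\<Sum>x\<in>G. \<mu> x * (v x)\<^sup>2) \<le> B) \<Longrightarrow>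
      finite F \<Longrightarrow> (norm_on F v)\<^sup>2 \<le> K * B"
    using norm_on_sq_le_L2 by metis
  \<comment> \<open>The finite sum over the whole support serves as \<open>B\<close>.\<close>
  have "(\<Sum>x\<in>G. \<mu> x * (v x)\<^sup>2) \<le> (\<Sum>x | v x \<noteq> 0. \<mu> x * (v x)\<^sup>2)" if "finite G" for G
  proof -
    have "(\<Sum>x\<in>G. \<mu> x * (v x)\<^sup>2) = (\<Sum>x | x \<in> G \<and> v x \<noteq> 0. \<mu> x * (v x)\<^sup>2)"
      using that by (intro sum.mono_neutral_right) auto
    also have "\<dots> \<le> (\<Sum>x | v x \<noteq> 0. \<mu> x * (v x)\<^sup>2)"
      using fin measure_pos by (intro sum_mono2) (auto simp: less_imp_le)
    finally show ?thesis .
  qed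
  from K[OF this] have "norm_on F v \<le> sqrt (K * (\<Sum>x | v x \<noteq> 0. \<mu> x * (v x)\<^sup>2))"
    if "finite F" for F
    using that by (intro real_le_rsqrt)
  then show "v \<in> W12 E \<mu> \<omega>"
    by (rule W12_bounded(1))
qed

text \<open>Cutting \<open>u\<close> off outside a finite set may create differences along boundary
  edges, but \<open>norm_on_sq_le_L2\<close> makes it enough that the tail of
  \<open>\<integral> u\<^sup>2 d\<mu>\<close> be small.\<close>

lemma finitely_supported_dense:
  assumes u: "u \<in> W12 E \<mu> \<omega>" and "\<epsilon> > 0"
  obtains v where "v \<in> finitely_supported" "W12_norm E \<mu> \<omega> (u - v) < \<epsilon>"
proof -
  obtain K where "K > 0" and K: "\<And>v B F. (\<And>G. finite G \<Longrightarrow> (\<Sum>x\<in>G. \<mu> x * (v x)\<^sup>2) \<le> B) \<Longrightarrow>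
      finite F \<Longrightarrow> (norm_on F v)\<^sup>2 \<le> K * B"
    using norm_on_sq_le_L2 by metis
  let ?h = "\<lambda>x. \<mu> x * (u x)\<^sup>2"
  have h_nonneg: "0 \<le> ?h x" for x
    using measure_pos[of x] by simp
  have "?h summable_on UNIV"
  proof (rule summable_on_comparison_test)
    show "(\<lambda>x. \<mu> x * (grad_sq E \<mu> \<omega> u x + (u x)\<^sup>2)) summable_on UNIV"
      using u by (simp add: W12_def graph_integrable_def)
    show "?h x \<le> \<mu> x * (grad_sq E \<mu> \<omega> u x + (u x)\<^sup>2)" for x
      unfolding density_eq using weight_nonneg by (simp add: sum_nonneg)
  qed (rule h_nonneg)
  then have h: "(?h has_sum infsum ?h UNIV) UNIV"
    by simp
  \<comment> \<open>Chosen so that \<open>K * \<delta>\<close> is the square of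
    \<open>\<epsilon> / 2\<close>.\<close>
  define \<delta> where "\<delta> = (\<epsilon> / 2)\<^sup>2 / K"
  have "\<delta> > 0"
    using \<open>K > 0\<close> \<open>\<epsilon> > 0\<close> by (simp add: \<delta>_def)
  from has_sum_finite_approximation[OF h this]
  obtain F where "finite F" and F: "dist (sum ?h F) (infsum ?h UNIV) \<le> \<delta>"
    by blast
  define v where "v = (\<lambda>x. if x \<in> F then u x else 0)"
  have "(\<Sum>x\<in>G. \<mu> x * ((u - v) x)\<^sup>2) \<le> \<delta>" if "finite G" for G
  proof -
    \<comment> \<open>The difference vanishes on \<open>F\<close> and equals \<open>u\<close>
      elsewhere, so only a part of the tail beyond \<open>F\<close> is left.\<close>
    have "(\<Sum>x\<in>G. \<mu> x * ((u - v) x)\<^sup>2) = sum ?h (G - F)"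
      using that by (intro sum.mono_neutral_cong_right) (auto simp: v_def)
    also have "\<dots> = sum ?h (F \<union> (G - F)) - sum ?h F"
      using \<open>finite F\<close> that by (subst sum.union_disjoint) auto
    also have "\<dots> \<le> infsum ?h UNIV - sum ?h F"
      using \<open>?h summable_on UNIV\<close> \<open>finite F\<close> that h_nonneg
      by (intro diff_right_mono finite_sum_le_infsum) auto
    also have "\<dots> \<le> \<delta>"
      using F by (simp add: dist_real_def)
    finally show ?thesis .
  qed
  from K[OF this] have "(norm_on G (u - v))\<^sup>2 \<le> (\<epsilon> / 2)\<^sup>2" if "finite G" for G
    using that \<open>K > 0\<close> by (simp add: \<delta>_def del: minus_apply)
  then have "norm_on G (u - v) \<le> \<epsilon> / 2" if "finite G" for G
    using that \<open>\<epsilon> > 0\<close> by (meson half_gt_zero less_imp_le power2_le_imp_le)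
  then have "W12_norm E \<mu> \<omega> (u - v) \<le> \<epsilon> / 2"
    by (rule W12_bounded(2))
  moreover have "v \<in> finitely_supported"
    using \<open>finite F\<close> by (simp add: finitely_supported_def v_def)
  ultimately show thesis
    using that \<open>\<epsilon> > 0\<close> by simp
qed

end

section \<open>Assembling the completion\<close>

lemma subspace_finitely_supported: "subspace finitely_supported"
  unfolding subspace_def
proof (intro conjI ballI allI)
  fix u v :: "'v \<Rightarrow> real"
  assume "u \<in> finitely_supported" "v \<in> finitely_supported"
  then have "finite ({x. u x \<noteq> 0} \<union> {x. v x \<noteq> 0})"
    by (simp add: finitely_supported_def)
  then show "u + v \<in> finitely_supported"
    unfolding finitely_supported_def mem_Collect_eq by (rule rev_finite_subset) auto
next
  fix c and u :: "'v \<Rightarrow> real"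
  assume "u \<in> finitely_supported"
  then have "finite {x. u x \<noteq> 0}"
    by (simp add: finitely_supported_def)
  then show "c *\<^sub>R u \<in> finitely_supported"
    unfolding finitely_supported_def mem_Collect_eq by (rule rev_finite_subset) auto
qed (simp add: finitely_supported_def)

theorem proposition2p1:
  fixes E :: "'v set set" and \<mu> :: "'v \<Rightarrow> real" and \<omega> :: "'v \<Rightarrow> 'v \<Rightarrow> real"
  assumes "weighted_graph E \<mu> \<omega>"
  shows "is_completion (W12_norm E \<mu> \<omega>) finitely_supported (W12 E \<mu> \<omega>)"
proof -
  interpret weighted_graph E \<mu> \<omega>
    by (rule assms)
  interpret W: Metric_space "W12 E \<mu> \<omega>" "\<lambda>u v. W12_norm E \<mu> \<omega> (u - v)"
    by (rule Metric_space_W12)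
  have "W.mtopology closure_of finitely_supported = W12 E \<mu> \<omega>"
  proof (rule antisym)
    show "W.mtopology closure_of finitely_supported \<subseteq> W12 E \<mu> \<omega>"
      using closure_of_subset_topspace[of W.mtopology] by simp
    show "W12 E \<mu> \<omega> \<subseteq> W.mtopology closure_of finitely_supported"
    proof
      fix u assume u: "u \<in> W12 E \<mu> \<omega>"
      \<comment> \<open>Membership in \<open>mball\<close> also requires both points to lie in W12,
        hence the use of \<open>finitely_supported_subset_W12\<close>.\<close>
      have "\<exists>v\<in>finitely_supported. v \<in> W.mball u r" if "r > 0" for r
        using finitely_supported_dense[OF u that] finitely_supported_subset_W12 u
        by (metis W.in_mball subsetD)
      with u show "u \<in> W.mtopology closure_of finitely_supported"
        by (simp add: W.metric_closure_of)
    qed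
  qed
  then show ?thesis
    unfolding is_completion_def
    using normed_subspace_W12 mcomplete_W12 subspace_finitely_supported
      finitely_supported_subset_W12 by blast
qed

end
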